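(* There is no finite simple connected chordal graph $G$ without isolated vertices such that $\gamma_t(G)=\gamma_{gr}^t(G)=4$.
   Context: A graph is chordal if it contains no induced cycle of length greater than $3$. For a vertex $v$ of a graph $G$, $N(v)$ denotes the open neighborhood (set of neighbors) of $v$. Let $G$ be a graph without isolated vertices. A set $S\subseteq V(G)$ is a total dominating set if every vertex of $G$ has a neighbor in $S$; the total domination number $\gamma_t(G)$ is the minimum cardinality of a total dominating set. A sequence $(v_1,\dots,v_k)$ of distinct vertices of $G$ is legal if $N(v_i)\setminus\bigcup_{j<i}N(v_j)\neq\emptyset$ for every $i\in\{2,\dots,k\}$. A legal sequence whose underlying set $\{v_1,\dots,v_k\}$ is a total dominating set is a total dominating sequence. The Grundy total domination number $\gamma_{gr}^t(G)$ is the maximum length of a total dominating sequence of $G$. *)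

theory Defs
  imports "Graph_Theory.Graph_Theory"
begin

text \<open>
  A finite simple graph is a \<^locale>\<open>pair_graph\<close>: a finite vertex set with a symmetric,
  irreflexive set of ordered pairs, so every edge is stored in both orientations.
\<close>

definition neighborhood :: "'a pair_pre_digraph \<Rightarrow> 'a \<Rightarrow> 'a set" where
  "neighborhood G v = {u. (v, u) \<in> parcs G}"

definition no_isolated_vertices :: "'a pair_pre_digraph \<Rightarrow> bool" where
  "no_isolated_vertices G \<longleftrightarrow> (\<forall>v \<in> pverts G. neighborhood G v \<noteq> {})"

text \<open>
  A cycle \<open>p\<close> is a closed walk, given as its list of directed edges, without repeated vertices;
  its length is the number of its edges, and its vertex set is \<open>fst ` set p\<close>.  It is induced if the
  subgraph of \<open>G\<close> induced on its vertices has no edges other than those of \<open>p\<close> (which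
  appear there in both orientations).
\<close>

definition induced_cycle :: "'a pair_pre_digraph \<Rightarrow> ('a \<times> 'a) list \<Rightarrow> bool" where
  "induced_cycle G p \<longleftrightarrow>
     pre_digraph.cycle (with_proj G) p \<and>
     arcs (with_proj G \<restriction> (fst ` set p)) = set p \<union> (set p)\<inverse>"

definition chordal :: "'a pair_pre_digraph \<Rightarrow> bool" where
  "chordal G \<longleftrightarrow> \<not> (\<exists>p. induced_cycle G p \<and> length p > 3)"

definition total_dominating_set :: "'a pair_pre_digraph \<Rightarrow> 'a set \<Rightarrow> bool" where
  "total_dominating_set G S \<longleftrightarrow>
     S \<subseteq> pverts G \<and> (\<forall>v \<in> pverts G. neighborhood G v \<inter> S \<noteq> {})"

text \<open>Sequences are 0-indexed, so the first vertex is \<open>vs ! 0\<close>.\<close>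

definition legal :: "'a pair_pre_digraph \<Rightarrow> 'a list \<Rightarrow> bool" where
  "legal G vs \<longleftrightarrow>
     distinct vs \<and> set vs \<subseteq> pverts G \<and>
     (\<forall>i \<in> {1..<length vs}. neighborhood G (vs ! i) - (\<Union>j<i. neighborhood G (vs ! j)) \<noteq> {})"

definition total_dominating_sequence :: "'a pair_pre_digraph \<Rightarrow> 'a list \<Rightarrow> bool" where
  "total_dominating_sequence G vs \<longleftrightarrow> legal G vs \<and> total_dominating_set G (set vs)"

text \<open>
  For a finite graph without isolated vertices the sets below are finite and non-empty: the whole
  vertex set is total dominating, and so is the underlying set of a legal sequence of maximal length.
\<close>

definition total_domination_number :: "'a pair_pre_digraph \<Rightarrow> nat" where
  "total_domination_number G = Min (card ` {S. total_dominating_set G S})"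

definition grundy_total_domination_number :: "'a pair_pre_digraph \<Rightarrow> nat" where
  "grundy_total_domination_number G = Max (length ` {vs. total_dominating_sequence G vs})"

end

theory Submission
  imports Defs
begin

text \<open>
  A legal sequence that does not dominate everything can always be prolonged, so if \<open>\<gamma>\<^sub>t\<close> and
  the Grundy number are both 4, then no three vertices are total dominating and no legal sequence
  has length five.  Only these two consequences are used, together with connectedness and the
  absence of induced cycles of length 4, 5 and 6.

  Fix an edge \<open>ab\<close> and let \<open>R\<close> be the set of vertices adjacent to neither end.  The pair
  \<open>(a, b)\<close> is a legal start, so \<open>R\<close> is what two further vertices have to dominate, in whatever way
  they are chosen.  This is very restrictive: no neighbourhood contains \<open>R\<close>, and two
  distinct non-empty traces \<open>N(x) \<inter> R\<close> and \<open>N(y) \<inter> R\<close> always cover \<open>R\<close> (\<open>traces_cover\<close>).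

  Suppose first that \<open>R\<close> contains an edge \<open>xy\<close>.  Then \<open>R\<close> induces a complete multipartite graph,
  and every vertex with a non-empty trace on \<open>R\<close> misses exactly one of its parts.  The same holds for the
  set \<open>R'\<close> belonging to the edge \<open>xy\<close>, and there are no edges between \<open>R\<close> and \<open>R'\<close>.  Since the graph
  is connected, some \<open>c\<close> lies outside both sets, and it is the centre of an induced path
  \<open>p q c q' p'\<close> with \<open>p, q \<in> R\<close> and \<open>p', q' \<in> R'\<close>.  A vertex \<open>d\<close> left undominated by \<open>q, c, q'\<close> is
  then adjacent to \<open>p\<close> and \<open>p'\<close> and closes an induced hexagon.  Hence any two edges are equal, share
  an end, or are joined by an edge (\<open>edges_linked\<close>).

  Now two vertices \<open>c, d\<close> with different non-empty traces on \<open>R\<close> complete \<open>a, b\<close> to a total dominating set,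
  and the absence of induced cycles of length 4 and 5 forces \<open>a, b, c, d\<close> to be a clique.  As no
  three of them are total dominating, each has a private neighbour; the four private neighbours
  followed by \<open>a\<close> form a legal sequence of length five, which is impossible.
\<close>

section \<open>Graphs with both total domination numbers equal to four\<close>

text \<open>
  In the last assumption \<open>w\<^sub>i\<close> witnesses that \<open>v\<^sub>i\<close> dominates something new.  The first vertex needs
  no witness, and the witnesses already make the \<open>v\<^sub>i\<close> distinct.  The three vertices in
  \<open>undominated3\<close> may coincide, so smaller sets are covered as well.
\<close>

locale four_uniform_graph =
  fixes V :: "'a set" and adj :: "'a \<Rightarrow> 'a \<Rightarrow> bool" (infix "\<sim>" 50)
  assumes adj_vert: "u \<sim> v \<Longrightarrow> v \<in> V"
    and adj_sym: "u \<sim> v \<Longrightarrow> v \<sim> u"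
    and adj_irrefl: "\<not> v \<sim> v"
    and has_neighbour: "v \<in> V \<Longrightarrow> \<exists>u. u \<sim> v"
    and undominated3: "a \<in> V \<Longrightarrow> b \<in> V \<Longrightarrow> c \<in> V \<Longrightarrow> \<exists>v\<in>V. \<not> a \<sim> v \<and> \<not> b \<sim> v \<and> \<not> c \<sim> v"
    and no_legal5: "\<lbrakk>v1 \<in> V;
      v2 \<sim> w2; \<not> v1 \<sim> w2;
      v3 \<sim> w3; \<not> v1 \<sim> w3; \<not> v2 \<sim> w3;
      v4 \<sim> w4; \<not> v1 \<sim> w4; \<not> v2 \<sim> w4; \<not> v3 \<sim> w4;
      v5 \<sim> w5; \<not> v1 \<sim> w5; \<not> v2 \<sim> w5; \<not> v3 \<sim> w5; \<not> v4 \<sim> w5\<rbrakk> \<Longrightarrow> False"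
begin

lemma adj_commute: "u \<sim> v \<longleftrightarrow> v \<sim> u"
  using adj_sym by blast

lemma adj_verts: "u \<sim> v \<Longrightarrow> u \<in> V" "u \<sim> v \<Longrightarrow> v \<in> V"
  using adj_vert adj_sym by blast+

definition residue :: "'a \<Rightarrow> 'a \<Rightarrow> 'a set" where
  "residue a b = {r \<in> V. \<not> a \<sim> r \<and> \<not> b \<sim> r}"

definition trace :: "'a \<Rightarrow> 'a \<Rightarrow> 'a \<Rightarrow> 'a set" where
  "trace a b x = {r \<in> residue a b. x \<sim> r}"

lemma in_residue: "r \<in> residue a b \<longleftrightarrow> r \<in> V \<and> \<not> a \<sim> r \<and> \<not> b \<sim> r"
  by (simp add: residue_def)

lemma in_trace: "r \<in> trace a b x \<longleftrightarrow> r \<in> residue a b \<and> x \<sim> r"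
  by (simp add: trace_def)

lemma trace_nonempty: "r \<in> residue a b \<Longrightarrow> x \<sim> r \<Longrightarrow> trace a b x \<noteq> {}"
  using in_trace by blast

lemma trace_misses:
  assumes "a \<sim> b" "x \<in> V"
  shows "\<exists>r \<in> residue a b. \<not> x \<sim> r"
  using undominated3[of a b x] adj_verts assms by (auto simp: in_residue)

text \<open>
  If \<open>z\<close> were missed by both, then \<open>a, b\<close>, the two vertices in a suitable order and a neighbour
  of \<open>z\<close> would be a legal sequence of length five.
\<close>

lemma traces_cover:
  assumes ab: "a \<sim> b"
    and ne: "trace a b x \<noteq> {}" "trace a b y \<noteq> {}" "trace a b x \<noteq> trace a b y"
    and z: "z \<in> residue a b"
  shows "x \<sim> z \<or> y \<sim> z"
proof (rule ccontr)
  assume nz: "\<not> (x \<sim> z \<or> y \<sim> z)"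
  obtain w where w: "w \<sim> z"
    using has_neighbour[of z] z by (auto simp: in_residue)
  \<comment> \<open>The order matters: the second vertex must reach outside the trace of the first.  Distinct sets
    are not included in each other both ways, so one of the two orders works.\<close>
  have extend: False if xy: "\<not> trace a b y' \<subseteq> trace a b x'" "trace a b x' \<noteq> {}"
    "\<not> x' \<sim> z" "\<not> y' \<sim> z" for x' y'
  proof -
    obtain r where r: "r \<in> residue a b" "x' \<sim> r" using xy by (auto simp: in_trace)
    obtain s where s: "s \<in> residue a b" "y' \<sim> s" "\<not> x' \<sim> s" using xy by (auto simp: in_trace)
    show False
      by (rule no_legal5[of a b a x' r y' s w z])
        (use ab r s w z xy adj_verts adj_irrefl adj_sym in \<open>auto simp: in_residue\<close>)
  qed
  show False
    using extend[of y x] extend[of x y] ne nz by blast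
qed

lemma edge_in_residue_dominates:
  assumes ab: "a \<sim> b" and xy: "x \<sim> y" "x \<in> residue a b" "y \<in> residue a b"
    and r: "r \<in> residue a b"
  shows "x \<sim> r \<or> y \<sim> r"
proof (rule traces_cover[OF ab _ _ _ r])
  have "y \<in> trace a b x" "x \<in> trace a b y" "x \<notin> trace a b x"
    using xy adj_sym adj_irrefl by (auto simp: in_trace)
  then show "trace a b x \<noteq> {}" "trace a b y \<noteq> {}" "trace a b x \<noteq> trace a b y" by auto
qed

lemma trace_eq_of_common_miss:
  assumes ab: "a \<sim> b" and "trace a b c \<noteq> {}" "trace a b p \<noteq> {}"
    and "z \<in> residue a b" "\<not> c \<sim> z" "\<not> p \<sim> z"
  shows "trace a b c = trace a b p"
  using traces_cover[of a b c p z] assms by blast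

text \<open>
  When the residue contains an edge, the vertices of the residue that miss \<open>p\<close> are exactly the part
  of \<open>p\<close> in a complete multipartite graph.  A vertex \<open>c\<close> that misses \<open>p\<close> but has a neighbour in the
  residue misses this part and, within the residue, nothing else.
\<close>

lemma trace_is_vertex_trace:
  assumes ab: "a \<sim> b" and xy: "x \<sim> y" "x \<in> residue a b" "y \<in> residue a b"
    and p: "p \<in> residue a b" and c: "trace a b c \<noteq> {}" "\<not> c \<sim> p"
  shows "trace a b c = trace a b p"
proof (rule trace_eq_of_common_miss[OF ab c(1) _ p c(2)])
  have "x \<sim> p \<or> y \<sim> p" by (rule edge_in_residue_dominates[OF ab xy p])
  then show "trace a b p \<noteq> {}" using xy adj_sym trace_nonempty by blast
  show "\<not> p \<sim> p" by (rule adj_irrefl)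
qed

text \<open>
  A vertex \<open>r'\<close> with a neighbour in the first residue misses only one part of it, but as a member of
  the second residue it misses both \<open>x\<close> and \<open>y\<close>, which lie in different parts.
\<close>

lemma no_edge_between_residues:
  assumes ab: "a \<sim> b" and xy: "x \<sim> y" "x \<in> residue a b" "y \<in> residue a b"
    and r: "r \<in> residue a b" and r': "r' \<in> residue x y"
  shows "\<not> r \<sim> r'"
proof
  assume rr': "r \<sim> r'"
  have ne: "trace a b r' \<noteq> {}"
    using rr' r adj_sym trace_nonempty by blast
  have miss: "\<not> r' \<sim> x" "\<not> r' \<sim> y"
    using r' adj_sym by (auto simp: in_residue)
  have "trace a b r' = trace a b x"
    by (rule trace_is_vertex_trace[OF ab xy xy(2) ne miss(1)])
  then show False
    using miss xy by (auto simp: in_trace)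
qed

text \<open>
  One arm of the induced path centred at \<open>c\<close>: \<open>p\<close> is taken from the part that \<open>c\<close> misses, \<open>q\<close> from
  another one.  The last two conclusions are what locates the sixth vertex of the hexagon: whatever
  is dominated by neither \<open>c\<close> nor \<open>q\<close> lies outside the residue, and if it has a neighbour in the
  residue then the part it misses is that of \<open>q\<close>, so that it is adjacent to \<open>p\<close>.
\<close>

lemma induced_path_to_residue:
  assumes ab: "a \<sim> b" and xy: "x \<sim> y" "x \<in> residue a b" "y \<in> residue a b"
    and c: "trace a b c \<noteq> {}"
  obtains p q where "p \<in> residue a b" "q \<in> residue a b" "p \<sim> q" "q \<sim> c" "\<not> p \<sim> c"
    "\<And>r. r \<in> residue a b \<Longrightarrow> c \<sim> r \<or> q \<sim> r"
    "\<And>d. trace a b d \<noteq> {} \<Longrightarrow> \<not> d \<sim> q \<Longrightarrow> d \<sim> p"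
proof -
  have "c \<in> V" using c adj_verts by (auto simp: in_trace)
  then obtain p where p: "p \<in> residue a b" "\<not> c \<sim> p"
    using trace_misses[OF ab] by blast
  obtain q where q: "q \<in> residue a b" "c \<sim> q" using c by (auto simp: in_trace)
  have cp: "trace a b c = trace a b p"
    by (rule trace_is_vertex_trace[OF ab xy p(1) c p(2)])
  then have pq: "p \<sim> q" using q unfolding set_eq_iff by (auto simp: in_trace)
  have q_ne: "trace a b q \<noteq> {}" "q \<notin> trace a b q" "p \<in> trace a b q"
    using pq p q adj_sym adj_irrefl in_trace by blast+
  have q_c: "trace a b c \<noteq> trace a b q"
    using q q_ne by (auto simp: in_trace)
  show thesis
  proof
    show "p \<in> residue a b" "q \<in> residue a b" "p \<sim> q" "q \<sim> c" "\<not> p \<sim> c"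
      using p q pq adj_sym by auto
    show "c \<sim> r \<or> q \<sim> r" if "r \<in> residue a b" for r
      by (rule traces_cover[OF ab c q_ne(1) q_c that])
    show "d \<sim> p" if d: "trace a b d \<noteq> {}" "\<not> d \<sim> q" for d
    proof -
      have "trace a b d = trace a b q"
        by (rule trace_is_vertex_trace[OF ab xy q(1) d])
      then show ?thesis using q_ne by (auto simp: in_trace)
    qed
  qed
qed

end

section \<open>Chordal graphs\<close>

text \<open>
  Connectedness says that a set closed under adjacency and containing a vertex is everything.  For
  the cycles of length 5 and 6 the adjacencies already force the vertices to be distinct, whereas
  opposite vertices of a 4-cycle are twins and could coincide.
\<close>

locale four_uniform_chordal_graph = four_uniform_graph +
  assumes connected: "\<lbrakk>A \<subseteq> V; u \<in> A; v \<in> V; \<And>s t. s \<in> A \<Longrightarrow> s \<sim> t \<Longrightarrow> t \<in> A\<rbrakk> \<Longrightarrow> v \<in> A"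
    and no_hole4: "\<lbrakk>a \<sim> b; b \<sim> c; c \<sim> d; d \<sim> a; a \<noteq> c; b \<noteq> d\<rbrakk> \<Longrightarrow> a \<sim> c \<or> b \<sim> d"
    and no_hole5: "\<lbrakk>a \<sim> b; b \<sim> c; c \<sim> d; d \<sim> e; e \<sim> a;
      \<not> a \<sim> c; \<not> a \<sim> d; \<not> b \<sim> d; \<not> b \<sim> e; \<not> c \<sim> e\<rbrakk> \<Longrightarrow> False"
    and no_hole6: "\<lbrakk>a \<sim> b; b \<sim> c; c \<sim> d; d \<sim> e; e \<sim> f; f \<sim> a;
      \<not> a \<sim> c; \<not> a \<sim> d; \<not> a \<sim> e; \<not> b \<sim> d; \<not> b \<sim> e; \<not> b \<sim> f; \<not> c \<sim> e; \<not> c \<sim> f; \<not> d \<sim> f\<rbrakk>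
      \<Longrightarrow> False"
begin

text \<open>
  If two edges were not linked, each would lie in the residue of the other, and the two induced
  arms at a vertex outside both residues would close to an induced hexagon.
\<close>

lemma edges_linked:
  assumes ab: "a \<sim> b" and xy: "x \<sim> y"
  shows "a \<sim> x \<or> a \<sim> y \<or> b \<sim> x \<or> b \<sim> y"
proof (rule ccontr)
  assume "\<not> ?thesis"
  then have xy_res: "x \<in> residue a b" "y \<in> residue a b"
    and ab_res: "a \<in> residue x y" "b \<in> residue x y"
    using ab xy adj_verts adj_sym by (auto simp: in_residue)
  note sep = no_edge_between_residues[OF ab xy xy_res]
  have connecting: "trace a b c \<noteq> {}" "trace x y c \<noteq> {}"
    if "c \<in> V" "c \<notin> residue a b" "c \<notin> residue x y" for c
    using that ab_res xy_res adj_sym by (auto simp: trace_def in_residue)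
  \<comment> \<open>Otherwise the two residues would be unions of components.\<close>
  have "\<exists>c \<in> V. c \<notin> residue a b \<and> c \<notin> residue x y"
  proof (rule ccontr)
    assume no_c: "\<not> ?thesis"
    have "a \<in> residue a b"
    proof (rule connected[of "residue a b" x])
      show "residue a b \<subseteq> V" by (auto simp: in_residue)
      show "x \<in> residue a b" by fact
      show "a \<in> V" using ab adj_verts by blast
      show "t \<in> residue a b" if "s \<in> residue a b" "s \<sim> t" for s t
        using no_c sep that adj_verts by blast
    qed
    then show False using ab adj_sym by (auto simp: in_residue)
  qed
  then obtain c where c: "c \<in> V" "c \<notin> residue a b" "c \<notin> residue x y" by blast
  obtain p q where pq: "p \<in> residue a b" "q \<in> residue a b" "p \<sim> q" "q \<sim> c" "\<not> p \<sim> c"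
    "\<And>r. r \<in> residue a b \<Longrightarrow> c \<sim> r \<or> q \<sim> r"
    "\<And>d. trace a b d \<noteq> {} \<Longrightarrow> \<not> d \<sim> q \<Longrightarrow> d \<sim> p"
    using induced_path_to_residue[OF ab xy xy_res connecting(1)[OF c]] by metis
  obtain p' q' where pq': "p' \<in> residue x y" "q' \<in> residue x y" "p' \<sim> q'" "q' \<sim> c" "\<not> p' \<sim> c"
    "\<And>r. r \<in> residue x y \<Longrightarrow> c \<sim> r \<or> q' \<sim> r"
    "\<And>d. trace x y d \<noteq> {} \<Longrightarrow> \<not> d \<sim> q' \<Longrightarrow> d \<sim> p'"
    using induced_path_to_residue[OF xy ab ab_res connecting(2)[OF c]] by metis
  obtain d where d: "d \<in> V" "\<not> q \<sim> d" "\<not> c \<sim> d" "\<not> q' \<sim> d"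
    using undominated3[of q c q'] pq(2) pq'(2) c(1) by (auto simp: in_residue)
  have d_out: "d \<notin> residue a b" "d \<notin> residue x y"
    using d pq(6) pq'(6) by blast+
  have "d \<sim> p" "d \<sim> p'"
    using connecting[OF d(1) d_out] pq(7) pq'(7) d adj_sym by blast+
  then show False
    using no_hole6[of d p q c q' p'] pq(1-5) pq'(1-5) d sep adj_sym by blast
qed

text \<open>
  Two vertices with different non-empty traces on the residue of \<open>ab\<close> complete \<open>a, b\<close> to a total dominating
  set.  No trace is the whole residue while the two together cover it, so each has a private
  neighbour there.
\<close>

lemma private_neighbour_pair:
  assumes ab: "a \<sim> b"
  obtains c d r s where "c \<sim> r" "d \<sim> s" "\<not> c \<sim> s" "\<not> d \<sim> r" "\<not> r \<sim> s"
    "\<not> a \<sim> r" "\<not> b \<sim> r" "\<not> a \<sim> s" "\<not> b \<sim> s"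
    "\<And>v. v \<in> V \<Longrightarrow> a \<sim> v \<or> b \<sim> v \<or> c \<sim> v \<or> d \<sim> v"
proof -
  obtain r0 where r0: "r0 \<in> residue a b"
    using trace_misses[OF ab] ab adj_verts by blast
  then obtain c where c: "c \<sim> r0"
    using has_neighbour by (auto simp: in_residue)
  then obtain s where s: "s \<in> residue a b" "\<not> c \<sim> s"
    using trace_misses[OF ab] adj_verts by blast
  then obtain d where d: "d \<sim> s"
    using has_neighbour by (auto simp: in_residue)
  have cover: "c \<sim> v \<or> d \<sim> v" if "v \<in> residue a b" for v
  proof (rule traces_cover[OF ab _ _ _ that])
    show "trace a b c \<noteq> {}" "trace a b d \<noteq> {}" "trace a b c \<noteq> trace a b d"
      using c d r0 s by (auto simp: trace_def)
  qed
  obtain r where r: "r \<in> residue a b" "\<not> d \<sim> r"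
    using trace_misses[OF ab] d adj_verts by blast
  show thesis
  proof (rule that)
    show "c \<sim> r" using cover r by blast
    show "\<not> r \<sim> s" using edges_linked[OF ab, of r s] r s by (auto simp: in_residue)
  qed (use r s d cover in \<open>auto simp: in_residue\<close>)
qed

text \<open>
  Every vertex of the clique has a private neighbour, because the other three are not total
  dominating.  The private neighbours come first in the sequence: each dominates its own clique
  vertex and none of the others.  They are independent, since an edge between two of them would
  give an induced 4-cycle; hence \<open>a\<close> dominates \<open>pa\<close> for the first time.
\<close>

lemma no_dominating_clique4:
  assumes clique: "a \<sim> b" "a \<sim> c" "a \<sim> d" "b \<sim> c" "b \<sim> d" "c \<sim> d"
    and dom: "\<And>v. v \<in> V \<Longrightarrow> a \<sim> v \<or> b \<sim> v \<or> c \<sim> v \<or> d \<sim> v"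
  shows False
proof -
  note in_V = adj_verts[OF clique(1)] adj_verts[OF clique(6)]
  obtain pa where pa: "a \<sim> pa" "\<not> b \<sim> pa" "\<not> c \<sim> pa" "\<not> d \<sim> pa"
    using undominated3[of b c d] dom in_V by blast
  obtain pb where pb: "b \<sim> pb" "\<not> a \<sim> pb" "\<not> c \<sim> pb" "\<not> d \<sim> pb"
    using undominated3[of a c d] dom in_V by blast
  obtain pc where pc: "c \<sim> pc" "\<not> a \<sim> pc" "\<not> b \<sim> pc" "\<not> d \<sim> pc"
    using undominated3[of a b d] dom in_V by blast
  obtain pd where pd: "d \<sim> pd" "\<not> a \<sim> pd" "\<not> b \<sim> pd" "\<not> c \<sim> pd"
    using undominated3[of a b c] dom in_V by blast
  have distinct: "a \<noteq> pb" "a \<noteq> pc" "a \<noteq> pd" "pa \<noteq> b" "pa \<noteq> c" "pa \<noteq> d"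
    using pa pb pc pd clique adj_sym by blast+
  have far: "\<not> pb \<sim> pa" "\<not> pc \<sim> pa" "\<not> pd \<sim> pa"
    using no_hole4[of a pa pb b] no_hole4[of a pa pc c] no_hole4[of a pa pd d]
      distinct pa pb pc pd clique adj_sym by metis+
  show False
    by (rule no_legal5[of pa pb b pc c pd d a pa])
      (use pa pb pc pd far adj_verts adj_irrefl in \<open>auto simp: adj_commute\<close>)
qed

text \<open>
  Without the edge \<open>bd\<close>, the edges \<open>bw\<close> and \<open>ds\<close> could only be linked by \<open>ws\<close>, and
  \<open>w s d a b\<close> would be an induced pentagon.
\<close>

lemma side_vertex_joined:
  assumes "a \<sim> b" "a \<sim> d" "b \<sim> w" "\<not> a \<sim> w" "\<not> d \<sim> w"
    and "d \<sim> s" "\<not> a \<sim> s" "\<not> b \<sim> s"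
  shows "b \<sim> d"
proof (rule ccontr)
  assume nbd: "\<not> b \<sim> d"
  have "w \<sim> s"
    using edges_linked[of b w d s] assms nbd adj_sym by blast
  then show False
    using no_hole5[of w s d a b] assms nbd adj_sym by blast
qed

text \<open>
  The triangle \<open>a c d\<close> is not total dominating, so \<open>b\<close> has a private neighbour, which by
  \<open>side_vertex_joined\<close> makes \<open>b\<close> adjacent to \<open>c\<close> and \<open>d\<close>: the dominating set is a clique.
\<close>

lemma no_triangle_over_edge:
  assumes ab: "a \<sim> b" and priv: "c \<sim> r" "d \<sim> s"
      "\<not> a \<sim> r" "\<not> b \<sim> r" "\<not> a \<sim> s" "\<not> b \<sim> s"
    and dom: "\<And>v. v \<in> V \<Longrightarrow> a \<sim> v \<or> b \<sim> v \<or> c \<sim> v \<or> d \<sim> v"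
    and triangle: "a \<sim> c" "a \<sim> d" "c \<sim> d"
  shows False
proof -
  obtain w where w: "b \<sim> w" "\<not> a \<sim> w" "\<not> c \<sim> w" "\<not> d \<sim> w"
    using undominated3[of a c d] dom triangle adj_verts by blast
  have "b \<sim> c" "b \<sim> d"
    using side_vertex_joined[OF ab _ w(1,2)] triangle priv w by blast+
  then show False
    using no_dominating_clique4[of a b c d] ab triangle dom by blast
qed

lemma no_edge: "\<not> a \<sim> b"
proof
  assume ab: "a \<sim> b"
  obtain c d r s where priv: "c \<sim> r" "d \<sim> s" "\<not> c \<sim> s" "\<not> d \<sim> r" "\<not> r \<sim> s"
    "\<not> a \<sim> r" "\<not> b \<sim> r" "\<not> a \<sim> s" "\<not> b \<sim> s"
    and dom: "\<And>v. v \<in> V \<Longrightarrow> a \<sim> v \<or> b \<sim> v \<or> c \<sim> v \<or> d \<sim> v"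
    using private_neighbour_pair[OF ab] by metis
  have cd: "c \<sim> d"
    using edges_linked[of c r d s] priv adj_sym by blast
  have c_ab: "a \<sim> c \<or> b \<sim> c" and d_ab: "a \<sim> d \<or> b \<sim> d"
    using edges_linked[OF ab] priv by blast+
  have "c \<noteq> a" "c \<noteq> b" "d \<noteq> a" "d \<noteq> b" using priv by blast+
  \<comment> \<open>If \<open>c\<close> and \<open>d\<close> hang on different ends of \<open>ab\<close>, a chord of the resulting 4-cycle
    provides the common neighbour.\<close>
  then have "(a \<sim> c \<and> a \<sim> d) \<or> (b \<sim> c \<and> b \<sim> d)"
    using c_ab d_ab no_hole4[of a c d b] no_hole4[of a d c b] ab cd adj_sym by blast
  then show False
  proof
    assume "a \<sim> c \<and> a \<sim> d"
    then show False using no_triangle_over_edge[of a b c r d s] ab priv dom cd by blast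
  next
    assume "b \<sim> c \<and> b \<sim> d"
    then show False
      using no_triangle_over_edge[of b a c r d s] adj_sym[OF ab] priv dom cd by blast
  qed
qed

lemma no_vertex: "V = {}"
  using has_neighbour no_edge by blast

end

section \<open>From sequences and cycles to the adjacency relation\<close>

lemma in_neighborhood: "u \<in> neighborhood G v \<longleftrightarrow> (v, u) \<in> parcs G"
  by (simp add: neighborhood_def)

lemma legal_singleton: "v \<in> pverts G \<Longrightarrow> legal G [v]"
  by (simp add: legal_def)

lemma legal_snoc:
  assumes "legal G vs" "v \<in> pverts G" "(v, w) \<in> parcs G" "\<forall>u \<in> set vs. (u, w) \<notin> parcs G"
  shows "legal G (vs @ [v])"
  unfolding legal_def
proof (intro conjI ballI)
  show "distinct (vs @ [v])" "set (vs @ [v]) \<subseteq> pverts G"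
    using assms by (auto simp: legal_def)
  fix i assume i: "i \<in> {1..<length (vs @ [v])}"
  show "neighborhood G ((vs @ [v]) ! i) - (\<Union>j<i. neighborhood G ((vs @ [v]) ! j)) \<noteq> {}"
  proof (cases "i = length vs")
    case True
    then have "w \<in> neighborhood G ((vs @ [v]) ! i) - (\<Union>j<i. neighborhood G ((vs @ [v]) ! j))"
      using assms(3,4) by (auto simp: in_neighborhood nth_append)
    then show ?thesis by blast
  next
    case False
    then have "i \<in> {1..<length vs}" using i by auto
    then show ?thesis
      using assms(1) by (auto simp: legal_def nth_append)
  qed
qed

context pair_graph
begin

lemma parcs_sym: "(u, v) \<in> parcs G \<Longrightarrow> (v, u) \<in> parcs G"
  using arcs_ends_symmetric[OF sym_arcs] by simp

text \<open>
  The greedy argument: a vertex without a neighbour in the sequence allows any of its own neighbours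
  to be appended.  It makes the Grundy number a bound on all legal sequences, not only
  on the dominating ones.
\<close>

lemma legal_extends:
  assumes iso: "no_isolated_vertices G" and "legal G vs"
  shows "\<exists>ts. total_dominating_sequence G ts \<and> length vs \<le> length ts"
  using assms(2)
proof (induction "card (pverts G) - length vs" arbitrary: vs rule: less_induct)
  case less
  show ?case
  proof (cases "total_dominating_set G (set vs)")
    case True
    then show ?thesis
      using less.prems by (auto simp: total_dominating_sequence_def)
  next
    case False
    have "set vs \<subseteq> pverts G" using less.prems by (simp add: legal_def)
    then obtain w where w: "w \<in> pverts G" "neighborhood G w \<inter> set vs = {}"
      using False by (auto simp: total_dominating_set_def)
    obtain v where v: "(w, v) \<in> parcs G"
      using iso w(1) by (auto simp: no_isolated_vertices_def neighborhood_def)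
    have longer: "legal G (vs @ [v])"
      by (rule legal_snoc[OF less.prems, of _ w])
        (use v w parcs_sym in_arcsD2 in \<open>auto simp: neighborhood_def\<close>)
    have "length (vs @ [v]) \<le> card (pverts G)"
      using longer card_mono[OF pair_finite_verts, of "set (vs @ [v])"] distinct_card[of "vs @ [v]"]
      by (auto simp: legal_def)
    then have "card (pverts G) - length (vs @ [v]) < card (pverts G) - length vs" by simp
    from less.hyps[OF this longer] show ?thesis by force
  qed
qed

lemma legal_length_le_grundy:
  assumes iso: "no_isolated_vertices G" and "legal G vs"
  shows "length vs \<le> grundy_total_domination_number G"
proof -
  obtain ts where ts: "total_dominating_sequence G ts" "length vs \<le> length ts"
    using legal_extends[OF assms] by blast
  have "{ts. total_dominating_sequence G ts} \<subseteq> {ts. set ts \<subseteq> pverts G \<and> distinct ts}"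
    by (auto simp: total_dominating_sequence_def legal_def)
  moreover have "finite {ts. set ts \<subseteq> pverts G \<and> distinct ts}"
    by (rule finite_subset_distinct[OF pair_finite_verts])
  ultimately have "finite {ts. total_dominating_sequence G ts}"
    by (rule finite_subset)
  then have "length ts \<le> grundy_total_domination_number G"
    unfolding grundy_total_domination_number_def using ts by (intro Max_ge) auto
  then show ?thesis using ts by simp
qed

lemma total_domination_number_le:
  assumes "total_dominating_set G S"
  shows "total_domination_number G \<le> card S"
proof -
  have "{S. total_dominating_set G S} \<subseteq> Pow (pverts G)"
    by (auto simp: total_dominating_set_def)
  then have "finite {S. total_dominating_set G S}"
    using pair_finite_verts by (simp add: finite_subset)
  then show ?thesis
    unfolding total_domination_number_def using assms by (intro Min_le) auto
qed

lemma connected_closed_set: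
  assumes conn: "connected (with_proj G)"
    and A: "u \<in> A" "u \<in> pverts G" "\<And>s t. s \<in> A \<Longrightarrow> (s, t) \<in> parcs G \<Longrightarrow> t \<in> A"
    and v: "v \<in> pverts G"
  shows "v \<in> A"
proof -
  have "u \<rightarrow>\<^sup>*\<^bsub>with_proj G\<^esub> v"
    using symmetric_connected_imp_strongly_connected[OF sym_arcs conn] A v
    by (auto simp: strongly_connected_def)
  then show ?thesis
    by (induction rule: reachable_induct) (use A in auto)
qed

text \<open>
  For an explicit list of arcs all premises reduce to finitely many adjacency facts, which is how the
  cycles of length 4, 5 and 6 below are recognised.
\<close>

lemma induced_cycleI:
  assumes p: "pcas u p u" "distinct (tl (pawalk_verts u p))" "p \<noteq> []" "set p \<subseteq> parcs G"
    and closed: "snd ` set p \<subseteq> fst ` set p"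
    and chords: "\<forall>s \<in> fst ` set p. \<forall>t \<in> fst ` set p.
      (s, t) \<in> parcs G \<longrightarrow> (s, t) \<in> set p \<or> (t, s) \<in> set p"
  shows "induced_cycle G p"
  unfolding induced_cycle_def
proof
  have "u \<in> pverts G"
    using p in_arcsD1 by (cases p) auto
  then show "cycle p"
    using p unfolding cycle_def awalk_def by auto
  have ends: "s \<in> fst ` set p \<and> t \<in> fst ` set p" if "(s, t) \<in> set p" for s t
    using that closed by force
  have "(s, t) \<in> arcs (with_proj G \<restriction> (fst ` set p)) \<longleftrightarrow> (s, t) \<in> set p \<union> (set p)\<inverse>" for s t
  proof
    assume "(s, t) \<in> arcs (with_proj G \<restriction> (fst ` set p))"
    then have "(s, t) \<in> parcs G" "s \<in> fst ` set p" "t \<in> fst ` set p" by simp_all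
    then show "(s, t) \<in> set p \<union> (set p)\<inverse>" using chords by blast
  next
    assume "(s, t) \<in> set p \<union> (set p)\<inverse>"
    then have "(s, t) \<in> parcs G" "s \<in> fst ` set p" "t \<in> fst ` set p"
      using p(4) parcs_sym ends by blast+
    then show "(s, t) \<in> arcs (with_proj G \<restriction> (fst ` set p))" by simp
  qed
  then show "arcs (with_proj G \<restriction> (fst ` set p)) = set p \<union> (set p)\<inverse>"
    unfolding set_eq_iff split_paired_All by blast
qed

lemma chordal_no_hole4:
  assumes "chordal G"
    and cyc: "(a, b) \<in> parcs G" "(b, c) \<in> parcs G" "(c, d) \<in> parcs G" "(d, a) \<in> parcs G"
    and ne: "a \<noteq> c" "b \<noteq> d"
  shows "(a, c) \<in> parcs G \<or> (b, d) \<in> parcs G"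
proof (rule ccontr)
  assume "\<not> ?thesis"
  then have "(a, c) \<notin> parcs G" "(b, d) \<notin> parcs G" "(c, a) \<notin> parcs G" "(d, b) \<notin> parcs G"
    using parcs_sym by blast+
  moreover have "distinct [a, b, c, d]"
    using ne cyc[THEN no_loops'] by auto
  ultimately have "induced_cycle G [(a, b), (b, c), (c, d), (d, a)]"
    using cyc no_loops' by (intro induced_cycleI[of a]) auto
  then show False using assms(1) by (auto simp: chordal_def)
qed

lemma chordal_no_hole5:
  assumes "chordal G"
    and cyc: "(a, b) \<in> parcs G" "(b, c) \<in> parcs G" "(c, d) \<in> parcs G"
      "(d, e) \<in> parcs G" "(e, a) \<in> parcs G"
    and non: "(a, c) \<notin> parcs G" "(a, d) \<notin> parcs G" "(b, d) \<notin> parcs G"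
      "(b, e) \<notin> parcs G" "(c, e) \<notin> parcs G"
  shows False
proof -
  have non': "(c, a) \<notin> parcs G" "(d, a) \<notin> parcs G" "(d, b) \<notin> parcs G"
    "(e, b) \<notin> parcs G" "(e, c) \<notin> parcs G"
    using non parcs_sym by blast+
  have "distinct [a, b, c, d, e]"
    using cyc[THEN no_loops'] cyc non non' by auto
  then have "induced_cycle G [(a, b), (b, c), (c, d), (d, e), (e, a)]"
    using cyc non non' no_loops' by (intro induced_cycleI[of a]) auto
  then show False using assms(1) by (auto simp: chordal_def)
qed

lemma chordal_no_hole6:
  assumes "chordal G"
    and cyc: "(a, b) \<in> parcs G" "(b, c) \<in> parcs G" "(c, d) \<in> parcs G"
      "(d, e) \<in> parcs G" "(e, f) \<in> parcs G" "(f, a) \<in> parcs G"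
    and non: "(a, c) \<notin> parcs G" "(a, d) \<notin> parcs G" "(a, e) \<notin> parcs G"
      "(b, d) \<notin> parcs G" "(b, e) \<notin> parcs G" "(b, f) \<notin> parcs G"
      "(c, e) \<notin> parcs G" "(c, f) \<notin> parcs G" "(d, f) \<notin> parcs G"
  shows False
proof -
  have non': "(c, a) \<notin> parcs G" "(d, a) \<notin> parcs G" "(e, a) \<notin> parcs G"
    "(d, b) \<notin> parcs G" "(e, b) \<notin> parcs G" "(f, b) \<notin> parcs G"
    "(e, c) \<notin> parcs G" "(f, c) \<notin> parcs G" "(f, d) \<notin> parcs G"
    using non parcs_sym by blast+
  have "distinct [a, b, c, d, e, f]"
    using cyc[THEN no_loops'] cyc non non' by auto
  then have "induced_cycle G [(a, b), (b, c), (c, d), (d, e), (e, f), (f, a)]"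
    using cyc non non' no_loops' by (intro induced_cycleI[of a]) auto
  then show False using assms(1) by (auto simp: chordal_def)
qed

lemma four_uniform_chordal_graphI:
  assumes conn: "connected (with_proj G)" and chordal: "chordal G"
    and iso: "no_isolated_vertices G"
    and td: "total_domination_number G = 4" and gr: "grundy_total_domination_number G = 4"
  shows "four_uniform_chordal_graph (pverts G) (\<lambda>u v. (u, v) \<in> parcs G)"
proof
  show "v \<in> pverts G" if "(u, v) \<in> parcs G" for u v
    using that in_arcsD2 by blast
  show "(v, u) \<in> parcs G" if "(u, v) \<in> parcs G" for u v
    using that parcs_sym by blast
  show "(v, v) \<notin> parcs G" for v
    using no_loops' by blast
  show "\<exists>u. (u, v) \<in> parcs G" if v: "v \<in> pverts G" for v
  proof -
    obtain u where "(v, u) \<in> parcs G"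
      using v iso by (auto simp: no_isolated_vertices_def neighborhood_def)
    then show ?thesis using parcs_sym by blast
  qed
  show "\<exists>v\<in>pverts G. (a, v) \<notin> parcs G \<and> (b, v) \<notin> parcs G \<and> (c, v) \<notin> parcs G"
    if abc: "a \<in> pverts G" "b \<in> pverts G" "c \<in> pverts G" for a b c
  proof (rule ccontr)
    assume "\<not> ?thesis"
    then have "total_dominating_set G {a, b, c}"
      using abc parcs_sym by (auto simp: total_dominating_set_def neighborhood_def)
    then have "4 \<le> card {a, b, c}" using total_domination_number_le td by force
    moreover have "card {a, b, c} \<le> 3"
      using card_length[of "[a, b, c]"] by simp
    ultimately show False by simp
  qed
  show False
    if v1: "v1 \<in> pverts G"
      and v2: "(v2, w2) \<in> parcs G" "(v1, w2) \<notin> parcs G"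
      and v3: "(v3, w3) \<in> parcs G" "(v1, w3) \<notin> parcs G" "(v2, w3) \<notin> parcs G"
      and v4: "(v4, w4) \<in> parcs G" "(v1, w4) \<notin> parcs G" "(v2, w4) \<notin> parcs G" "(v3, w4) \<notin> parcs G"
      and v5: "(v5, w5) \<in> parcs G" "(v1, w5) \<notin> parcs G" "(v2, w5) \<notin> parcs G" "(v3, w5) \<notin> parcs G"
        "(v4, w5) \<notin> parcs G"
    for v1 v2 w2 v3 w3 v4 w4 v5 w5
  proof -
    have "legal G [v1, v2]"
      using legal_snoc[OF legal_singleton[OF v1] _ v2(1)] v2 in_arcsD1 by auto
    then have "legal G [v1, v2, v3]"
      using legal_snoc[of G "[v1, v2]" v3 w3] v3 in_arcsD1 by auto
    then have "legal G [v1, v2, v3, v4]"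
      using legal_snoc[of G "[v1, v2, v3]" v4 w4] v4 in_arcsD1 by auto
    then have "legal G [v1, v2, v3, v4, v5]"
      using legal_snoc[of G "[v1, v2, v3, v4]" v5 w5] v5 in_arcsD1 by auto
    then show False
      using legal_length_le_grundy[OF iso] gr by force
  qed
  show "v \<in> A"
    if A: "A \<subseteq> pverts G" "u \<in> A" and v: "v \<in> pverts G"
      and closed: "\<And>s t. s \<in> A \<Longrightarrow> (s, t) \<in> parcs G \<Longrightarrow> t \<in> A" for A u v
  proof (rule connected_closed_set[OF conn A(2) _ _ v])
    show "u \<in> pverts G" using A by blast
    show "t \<in> A" if "s \<in> A" "(s, t) \<in> parcs G" for s t
      by (rule closed[OF that])
  qed
qed (fact chordal_no_hole4[OF chordal] chordal_no_hole5[OF chordal] chordal_no_hole6[OF chordal])+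

end

theorem theorem3p3:
  shows "\<not> (\<exists>G :: 'a pair_pre_digraph.
            pair_graph G \<and> connected (with_proj G) \<and> chordal G \<and> no_isolated_vertices G \<and>
            total_domination_number G = 4 \<and> grundy_total_domination_number G = 4)"
proof
  assume "\<exists>G :: 'a pair_pre_digraph.
            pair_graph G \<and> connected (with_proj G) \<and> chordal G \<and> no_isolated_vertices G \<and>
            total_domination_number G = 4 \<and> grundy_total_domination_number G = 4"
  then obtain G :: "'a pair_pre_digraph" where G: "pair_graph G" "connected (with_proj G)"
    "chordal G" "no_isolated_vertices G" "total_domination_number G = 4"
    "grundy_total_domination_number G = 4" by blast
  have "pverts G = {}"
    by (rule four_uniform_chordal_graph.no_vertex)
      (rule pair_graph.four_uniform_chordal_graphI[OF G])
  then have "total_dominating_set G {}" by (simp add: total_dominating_set_def)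
  then show False
    using pair_graph.total_domination_number_le[OF G(1)] G(5) by fastforce
qed

end
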